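(* Let $n\ge 3$, let $\Gamma$ be a tree on the $n+1$ vertices $v_1,\dots,v_{n+1}$, labelled so that $v_{n+1}$ is a pendant vertex of $\Gamma$, and let $v_r$ be the unique vertex of $\Gamma$ adjacent to $v_{n+1}$. Let $A=(a_{ij})\in\mathbf{M}_{n+1}(\mathbb{R})$ be a singular matrix satisfying the $\Gamma$-treeangle property, such that for every edge $\{v_i,v_j\}\in E(\Gamma)$ at least one of $a_{ij},a_{ji}$ is nonzero. Suppose that $a_{ii}\neq 0$ for all interior vertices $v_i$ of $\Gamma$, and that the leading principal submatrix $B\in\mathbf{M}_n(\mathbb{R})$ of $A$ (obtained by deleting the $(n+1)$-th row and column of $A$) is invertible. Let $G:=G(A^\dagger)$ be the graph associated with the Moore-Penrose inverse $A^\dagger$, and let the number $s_r$ and the set of edges $H$ be as defined in the context. Then $G$ is a tree if and only if one of the following holds: 1. $s_r\neq 0$ and $H$ is empty; 2. $s_r=0$ and $H$ is a singleton.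
   Context: All graphs are simple and undirected. $\mathbf{M}_m(\mathbb{R})$ is the set of real $m\times m$ matrices. $E(\Gamma)$ is the edge set of $\Gamma$; $N(v)$ is the set of vertices of $\Gamma$ adjacent to $v$, and $d(v)=|N(v)|$. A vertex $v$ is pendant if $d(v)=1$ and interior if $d(v)>1$. For a tree $\Gamma$ on vertices $v_1,\dots,v_m$, a matrix $A=(a_{ij})\in\mathbf{M}_m(\mathbb{R})$ satisfies the $\Gamma$-treeangle property if $a_{ij}a_{kk}=a_{ik}a_{kj}$ for every triplet of vertices $v_i,v_j,v_k$ such that $v_k$ lies in the (unique) path joining $v_i$ and $v_j$ in $\Gamma$. For $C=(c_{ij})\in\mathbf{M}_m(\mathbb{R})$, the graph $G(C)$ associated with $C$ has vertex set $\{v_1,\dots,v_m\}$, and for $i\ne j$, $\{v_i,v_j\}$ is an edge if and only if at least one of $c_{ij},c_{ji}$ is nonzero. The Moore-Penrose inverse $A^\dagger$ of a square real matrix $A$ is the unique matrix $X$ with $AXA=A$, $XAX=X$, $(AX)^T=AX$, $(XA)^T=XA$. Definition of $s_r$: put $d_{ij}=a_{ii}a_{jj}-a_{ij}a_{ji}$ (under the hypotheses of the claim, $d_{ij}\ne0$ for every edge $\{v_i,v_j\}$ of $\Gamma$ not incident to $v_{n+1}$) and $$s_r=\frac{1}{a_{rr}}\Big(1+\sum_{k:\ v_k\in N(v_r),\ k\neq n+1}\frac{a_{rk}a_{kr}}{d_{rk}}\Big).$$ Definition of $H$: put $$N'_r:=\{\{v_j,v_{n+1}\}: v_j\in N(v_r)\setminus\{v_{n+1}\}\text{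 and }a_{jr}\neq 0\},$$ $$N''_r:=\{\{v_j,v_{n+1}\}: v_j\in N(v_r)\setminus\{v_{n+1}\}\text{ and }a_{rj}\neq 0\}.$$ If $a_{r(n+1)}\neq 0$ and $a_{(n+1)r}=0$, then $H:=N''_r$; if $a_{(n+1)r}\neq 0$ and $a_{r(n+1)}=0$, then $H:=N'_r$; if both are nonzero, then $H:=N'_r\cup N''_r$. *)

theory Defs
  imports
    "Jordan_Normal_Form.Determinant"
    "Graph_Theory.Graph_Theory"
begin

text \<open>
  Simple undirected graphs are finite symmetric loop-free digraphs (\<open>pair_graph\<close>), so that an
  edge \<open>{u, v}\<close> is represented by the two arcs \<open>(u, v)\<close> and \<open>(v, u)\<close>.  The vertex \<open>v\<^sub>i\<close> is the
  natural number \<open>i - 1\<close>, in accordance with the zero-based indices of matrices; in particular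
  \<open>v\<^bsub>n+1\<^esub>\<close> is \<open>n\<close>.
\<close>

text \<open>
  The predicate \<open>tree\<close> of the graph library is meant for digraphs: there, the two arcs of an
  undirected edge form a cycle.  For undirected graphs only cycles of length at least 3 count.
\<close>

definition undirected_tree :: "'a pair_pre_digraph \<Rightarrow> bool" where
  "undirected_tree G \<longleftrightarrow>
     pair_graph G \<and> connected (with_proj G) \<and>
     \<not> (\<exists>p. pre_digraph.cycle (with_proj G) p \<and> 3 \<le> length p)"

definition nbrs :: "'a pair_pre_digraph \<Rightarrow> 'a \<Rightarrow> 'a set" where
  "nbrs G v = {u. (v, u) \<in> parcs G}"

definition pendant :: "'a pair_pre_digraph \<Rightarrow> 'a \<Rightarrow> bool" where
  "pendant G v \<longleftrightarrow> card (nbrs G v) = 1"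

definition interior_vertex :: "'a pair_pre_digraph \<Rightarrow> 'a \<Rightarrow> bool" where
  "interior_vertex G v \<longleftrightarrow> 1 < card (nbrs G v)"

text \<open>A \<open>vpath\<close> has no repeated vertices; in a tree it is determined by its two ends.\<close>

definition lies_on_path :: "'a pair_pre_digraph \<Rightarrow> 'a \<Rightarrow> 'a \<Rightarrow> 'a \<Rightarrow> bool" where
  "lies_on_path G i j k \<longleftrightarrow>
     (\<exists>p. vpath p (with_proj G) \<and> hd p = i \<and> last p = j \<and> k \<in> set p)"

definition treeangle :: "nat pair_pre_digraph \<Rightarrow> real mat \<Rightarrow> bool" where
  "treeangle G A \<longleftrightarrow>
     (\<forall>i\<in>pverts G. \<forall>j\<in>pverts G. \<forall>k\<in>pverts G. lies_on_path G i j k \<longrightarrow>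
        A $$ (i, j) * A $$ (k, k) = A $$ (i, k) * A $$ (k, j))"

definition graph_of_mat :: "real mat \<Rightarrow> nat pair_pre_digraph" where
  "graph_of_mat C =
     \<lparr> pverts = {0..<dim_row C},
       parcs = {(i, j). i < dim_row C \<and> j < dim_row C \<and> i \<noteq> j \<and>
                        (C $$ (i, j) \<noteq> 0 \<or> C $$ (j, i) \<noteq> 0)} \<rparr>"

definition is_moore_penrose :: "real mat \<Rightarrow> real mat \<Rightarrow> bool" where
  "is_moore_penrose A X \<longleftrightarrow>
     X \<in> carrier_mat (dim_col A) (dim_row A) \<and>
     A * X * A = A \<and> X * A * X = X \<and>
     transpose_mat (A * X) = A * X \<and> transpose_mat (X * A) = X * A"

definition moore_penrose :: "real mat \<Rightarrow> real mat" where
  "moore_penrose A = (THE X. is_moore_penrose A X)"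

text \<open>
  In the following definitions \<open>w\<close> is the distinguished pendant vertex \<open>v\<^bsub>n+1\<^esub>\<close> and \<open>r\<close> its
  neighbour \<open>v\<^sub>r\<close>.
\<close>

definition minor2 :: "real mat \<Rightarrow> nat \<Rightarrow> nat \<Rightarrow> real" where
  "minor2 A i j = A $$ (i, i) * A $$ (j, j) - A $$ (i, j) * A $$ (j, i)"

definition s_val :: "nat pair_pre_digraph \<Rightarrow> real mat \<Rightarrow> nat \<Rightarrow> nat \<Rightarrow> real" where
  "s_val G A w r =
     1 / A $$ (r, r) *
       (1 + (\<Sum>k\<in>nbrs G r - {w}. A $$ (r, k) * A $$ (k, r) / minor2 A r k))"

definition N' :: "nat pair_pre_digraph \<Rightarrow> real mat \<Rightarrow> nat \<Rightarrow> nat \<Rightarrow> nat set set" where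
  "N' G A w r = {{j, w} | j. j \<in> nbrs G r - {w} \<and> A $$ (j, r) \<noteq> 0}"

definition N'' :: "nat pair_pre_digraph \<Rightarrow> real mat \<Rightarrow> nat \<Rightarrow> nat \<Rightarrow> nat set set" where
  "N'' G A w r = {{j, w} | j. j \<in> nbrs G r - {w} \<and> A $$ (r, j) \<noteq> 0}"

text \<open>
  The last case is meant for both entries being nonzero; it also catches the irrelevant case that
  both vanish, in which \<open>H\<close> has no meaning.
\<close>

definition H_set :: "nat pair_pre_digraph \<Rightarrow> real mat \<Rightarrow> nat \<Rightarrow> nat \<Rightarrow> nat set set" where
  "H_set G A w r =
     (if A $$ (r, w) \<noteq> 0 \<and> A $$ (w, r) = 0 then N'' G A w r
      else if A $$ (w, r) \<noteq> 0 \<and> A $$ (r, w) = 0 then N' G A w r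
      else N' G A w r \<union> N'' G A w r)"

end

theory Submission
  imports Defs
begin

text \<open>
  Write \<open>w\<close> for the distinguished leaf \<open>n\<close>, \<open>r\<close> for its neighbour, \<open>B\<close> for \<open>A\<close> without row and
  column \<open>w\<close>, and \<open>C\<close> for the inverse of \<open>B\<close>.

  Since \<open>r\<close> lies on every path that ends in \<open>w\<close>, the treeangle property makes column \<open>w\<close> of \<open>A\<close> equal
  to \<open>t\<close> times column \<open>r\<close> and row \<open>w\<close> equal to \<open>u\<close> times row \<open>r\<close>, outside the corner entry, where
  \<open>t = a\<^bsub>rw\<^esub> / a\<^bsub>rr\<^esub>\<close> and \<open>u = a\<^bsub>wr\<^esub> / a\<^bsub>rr\<^esub>\<close>; as \<open>A\<close> is singular and \<open>B\<close> is not, the corner follows the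
  same pattern.  So \<open>A\<close> arises from \<open>B\<close> by duplicating the index \<open>r\<close> with weights: \<open>A = P B Q\<close> with \<open>P\<close>
  of full column rank and \<open>Q\<close> of full row rank (\<open>A_factorization\<close>).  For such a factorization the
  Moore-Penrose inverse is \<open>Q\<^sup>+ C P\<^sup>+\<close> (\<open>is_moore_penrose_full_rank_factorization\<close>), and here each of
  \<open>Q\<^sup>+\<close> and \<open>P\<^sup>+\<close> is again a duplication of \<open>r\<close>.  Up to nonzero factors, the Moore-Penrose inverse
  therefore is \<open>C\<close>, bordered by a row proportional to row \<open>r\<close> of \<open>C\<close> that is nonzero only if
  \<open>t \<noteq> 0\<close>, and a column proportional to column \<open>r\<close> of \<open>C\<close> that is nonzero only if \<open>u \<noteq> 0\<close>
  (\<open>moore_penrose_entry\<close>).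

  The inverse of \<open>B\<close> is explicit (\<open>inverse_column\<close>): its entry at an edge \<open>{k, i}\<close> is
  \<open>- a\<^bsub>ki\<^esub> / d\<^bsub>ik\<^esub>\<close>, its off-diagonal entries at non-edges vanish, and its entry at \<open>(r, r)\<close> is \<open>s\<^sub>r\<close>.
  The graph of the Moore-Penrose inverse hence agrees with the given tree away from \<open>w\<close>, while \<open>w\<close> is
  joined to \<open>r\<close> if and only if \<open>s\<^sub>r \<noteq> 0\<close>, and to the neighbours \<open>j\<close> of \<open>r\<close> with \<open>{j, w} \<in> H\<close>
  (\<open>nbrs_n\<close>).  Deleting a leaf from a tree leaves a tree, and adding a vertex to a tree gives a tree if
  and only if the new vertex gets exactly one neighbour (\<open>tree_exchange_leaf\<close>).  So the condition is
  that \<open>[s\<^sub>r \<noteq> 0] + card H = 1\<close>.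
\<close>

section \<open>Paths and cycles in undirected graphs\<close>

text \<open>
  Paths are lists of vertices here, so that cutting, joining and reversing them are list operations.
  A cycle is recorded by its vertices, each listed once.  The bound on the length excludes the two
  arcs of a single edge.
\<close>

definition simple_path :: "('a \<times> 'a) set \<Rightarrow> 'a list \<Rightarrow> bool" where
  "simple_path E p \<longleftrightarrow> p \<noteq> [] \<and> distinct p \<and> successively (\<lambda>x y. (x, y) \<in> E) p"

definition closed_path :: "('a \<times> 'a) set \<Rightarrow> 'a list \<Rightarrow> bool" where
  "closed_path E p \<longleftrightarrow> simple_path E p \<and> 3 \<le> length p \<and> (last p, hd p) \<in> E"

lemma set_vwalk_arcs_subset_iff:
  "set (vwalk_arcs p) \<subseteq> E \<longleftrightarrow> successively (\<lambda>x y. (x, y) \<in> E) p"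
  by (induction p rule: vwalk_arcs.induct) auto

lemma vpath_iff_simple_path:
  assumes "pair_graph G"
  shows "vpath p (with_proj G) \<longleftrightarrow> set p \<subseteq> pverts G \<and> simple_path (parcs G) p"
proof -
  interpret pair_graph G by fact
  show ?thesis
    unfolding vpath_def vwalk_def simple_path_def set_vwalk_arcs_subset_iff[symmetric]
    by auto
qed

lemma arcs_of_vwalk:
  "pcas u (vwalk_arcs (u # q)) (last (u # q)) \<and> pawalk_verts u (vwalk_arcs (u # q)) = u # q"
  by (induction q arbitrary: u) auto

lemma vertices_of_arcs:
  assumes "pcas u p v" "set p \<subseteq> E"
  shows "\<exists>q. pawalk_verts u p = u # q \<and> length q = length p \<and> last (u # q) = v
           \<and> successively (\<lambda>x y. (x, y) \<in> E) (u # q)"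
  using assms
proof (induction p arbitrary: u)
  case (Cons e p)
  then obtain q where q: "pawalk_verts (snd e) p = snd e # q" "length q = length p"
    "last (snd e # q) = v" "successively (\<lambda>x y. (x, y) \<in> E) (snd e # q)" by auto
  have "(u, snd e) \<in> E" using Cons.prems by (cases e) auto
  then show ?case using q Cons.prems by (intro exI[of _ "snd e # q"]) auto
qed auto

text \<open>
  A cyclic list of arcs visits its start vertex twice; dropping the first of these two visits leaves a
  repetition-free list of its vertices.
\<close>

lemma cycle_iff_closed_path:
  assumes "pair_graph G"
  shows "(\<exists>p. pre_digraph.cycle (with_proj G) p \<and> 3 \<le> length p) \<longleftrightarrow> (\<exists>q. closed_path (parcs G) q)"
proof -
  interpret pair_graph G by fact
  have cyc: "pre_digraph.cycle (with_proj G) p \<longleftrightarrow>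
     (\<exists>u. u \<in> pverts G \<and> set p \<subseteq> parcs G \<and> pcas u p u \<and> distinct (tl (pawalk_verts u p)) \<and> p \<noteq> [])" for p
    by (auto simp: pre_digraph.cycle_def pre_digraph.awalk_def)
  show ?thesis
  proof
    assume "\<exists>p. pre_digraph.cycle (with_proj G) p \<and> 3 \<le> length p"
    then obtain p u where p: "3 \<le> length p" "set p \<subseteq> parcs G" "pcas u p u"
      "distinct (tl (pawalk_verts u p))" using cyc by blast
    obtain q where q: "pawalk_verts u p = u # q" "length q = length p" "last (u # q) = u"
      "successively (\<lambda>x y. (x, y) \<in> parcs G) (u # q)"
      using vertices_of_arcs[OF p(3,2)] by auto
    have "q \<noteq> []" using p(1) q(2) by auto
    then have "closed_path (parcs G) q" using p q
      by (auto simp: closed_path_def simple_path_def successively_Cons)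
    then show "\<exists>q. closed_path (parcs G) q" ..
  next
    assume "\<exists>q. closed_path (parcs G) q"
    then obtain q where q: "q \<noteq> []" "distinct q" "successively (\<lambda>x y. (x, y) \<in> parcs G) q"
      "3 \<le> length q" "(last q, hd q) \<in> parcs G"
      by (auto simp: closed_path_def simple_path_def)
    define p where "p = vwalk_arcs (last q # q)"
    have "set p \<subseteq> parcs G" unfolding p_def set_vwalk_arcs_subset_iff
      using q by (simp add: successively_Cons)
    moreover have "length p = length q"
      using vwalk_length_simp[of "last q # q"] unfolding p_def vwalk_length_def by simp
    moreover have "last q \<in> pverts G" using q(5) in_arcsD1 by blast
    ultimately have "pre_digraph.cycle (with_proj G) p"
      unfolding cyc using arcs_of_vwalk[of "last q" q] q
      by (intro exI[of _ "last q"]) (auto simp: p_def)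
    then show "\<exists>p. pre_digraph.cycle (with_proj G) p \<and> 3 \<le> length p"
      using \<open>length p = length q\<close> q by auto
  qed
qed

lemma lies_on_pathI:
  assumes "pair_graph G" "simple_path (parcs G) p" "set p \<subseteq> pverts G" "k \<in> set p"
  shows "lies_on_path G (hd p) (last p) k"
  using assms by (auto simp: lies_on_path_def vpath_iff_simple_path)

lemma simple_path_rev:
  assumes "pair_graph G" shows "simple_path (parcs G) (rev p) \<longleftrightarrow> simple_path (parcs G) p"
proof -
  interpret pair_graph G by fact
  have "(y, x) \<in> parcs G \<longleftrightarrow> (x, y) \<in> parcs G" for x y
    using arcs_symmetric by blast
  then show ?thesis by (simp add: simple_path_def)
qed

definition path_linked :: "'a pair_pre_digraph \<Rightarrow> 'a \<Rightarrow> 'a \<Rightarrow> bool" where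
  "path_linked G u v \<longleftrightarrow> (\<exists>p. set p \<subseteq> pverts G \<and> simple_path (parcs G) p \<and> hd p = u \<and> last p = v)"

lemma undirected_tree_iff:
  "undirected_tree G \<longleftrightarrow> pair_graph G \<and> pverts G \<noteq> {} \<and>
     (\<forall>u\<in>pverts G. \<forall>v\<in>pverts G. path_linked G u v) \<and> (\<nexists>p. closed_path (parcs G) p)"
proof (cases "pair_graph G")
  case True
  then interpret pair_graph G .
  have "mk_symmetric (with_proj G) = G"
    using arcs_symmetric by (intro pair_pre_digraph.equality) (auto simp: mk_symmetric_def)
  then have "connected (with_proj G) \<longleftrightarrow> strongly_connected (with_proj G)"
    by (simp add: connected_def)
  also have "\<dots> \<longleftrightarrow> pverts G \<noteq> {} \<and> (\<forall>u\<in>pverts G. \<forall>v\<in>pverts G. path_linked G u v)"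
    by (auto simp: strongly_connected_def reachable_vpath_conv path_linked_def
        vpath_iff_simple_path[OF True])
  finally show ?thesis using True by (simp add: undirected_tree_def cycle_iff_closed_path)
qed (simp add: undirected_tree_def)

lemma lies_on_path_sym:
  assumes "pair_graph G" "lies_on_path G i j k" shows "lies_on_path G j i k"
proof -
  obtain p where p: "set p \<subseteq> pverts G" "simple_path (parcs G) p" "hd p = i" "last p = j" "k \<in> set p"
    using assms by (auto simp: lies_on_path_def vpath_iff_simple_path)
  then have "p \<noteq> []" by (simp add: simple_path_def)
  then show ?thesis unfolding lies_on_path_def vpath_iff_simple_path[OF assms(1)]
    using p assms(1) by (intro exI[of _ "rev p"]) (simp add: simple_path_rev hd_rev last_rev)
qed

text \<open>
  Seen from \<open>x\<close>, the tree hangs down to \<open>i\<close> through exactly one neighbour \<open>b\<close> of \<open>i\<close>, the one on the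
  path between \<open>x\<close> and \<open>i\<close>, and the other neighbours \<open>j\<close> are behind \<open>i\<close>.  The treeangle property
  enters through this dichotomy.  The disjunction says that \<open>b\<close> is not a leaf unless the path ends
  there.
\<close>

lemma tree_branch:
  assumes tree: "undirected_tree G" and i: "i \<in> pverts G" and x: "x \<in> pverts G" and "x \<noteq> i"
  shows "\<exists>b\<in>nbrs G i. (b = x \<or> (\<exists>c\<in>nbrs G b. c \<noteq> i)) \<and> lies_on_path G x i b
           \<and> (\<forall>j\<in>nbrs G i - {b}. lies_on_path G x j i)"
proof -
  have pg: "pair_graph G" using tree by (simp add: undirected_tree_iff)
  interpret pair_graph G by fact
  obtain p where p: "set p \<subseteq> pverts G" "simple_path (parcs G) p" "hd p = i" "last p = x"
    using tree i x unfolding undirected_tree_iff path_linked_def by blast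
  obtain b q where pq: "p = i # b # q"
    using p \<open>x \<noteq> i\<close> by (cases p rule: remdups_adj.cases) (auto simp: simple_path_def)
  have b: "b \<in> nbrs G i" using p pq by (auto simp: nbrs_def simple_path_def)
  have "b = x \<or> (\<exists>c\<in>nbrs G b. c \<noteq> i)"
    using p pq by (cases q) (auto simp: nbrs_def simple_path_def)
  moreover have "lies_on_path G x i b"
    using lies_on_path_sym[OF pg] lies_on_pathI[OF pg p(2,1), of b] p pq by auto
  moreover have "lies_on_path G x j i" if j: "j \<in> nbrs G i - {b}" for j
  proof -
    have ij: "(i, j) \<in> parcs G" "(j, i) \<in> parcs G" "j \<noteq> b"
      using j arcs_symmetric by (auto simp: nbrs_def)
    \<comment> \<open>otherwise the path from \<open>i\<close> to \<open>j\<close> along \<open>p\<close> closes up to a cycle\<close>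
    have "j \<notin> set p"
    proof
      assume "j \<in> set p"
      then have "j \<in> set q" using ij pq no_loops'[OF ij(1)] by auto
      then obtain q1 q2 where "q = q1 @ j # q2" by (meson split_list)
      then have "closed_path (parcs G) (i # b # q1 @ [j])"
        using p(2) pq ij by (auto simp: closed_path_def simple_path_def successively_append_iff successively_Cons
            hd_append split: if_splits)
      then show False using tree by (auto simp: undirected_tree_iff)
    qed
    then have "simple_path (parcs G) (j # p)"
      using p(2) pq ij by (auto simp: simple_path_def)
    then have "lies_on_path G (hd (j # p)) (last (j # p)) i"
      by (rule lies_on_pathI[OF pg]) (use p pq ij(1) in_arcsD2 in auto)
    then show ?thesis using lies_on_path_sym[OF pg] p pq by auto
  qed
  ultimately show ?thesis using b by blast
qed

section \<open>Exchanging the edges at a leaf\<close>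

lemma closed_path_rotate:
  assumes "closed_path E (xs @ ys)" shows "closed_path E (ys @ xs)"
  using assms by (cases "xs = []"; cases "ys = []")
    (auto simp: closed_path_def simple_path_def successively_append_iff)

lemma simple_path_congI:
  assumes "simple_path E p" "w \<notin> set p"
    "\<And>i j. i \<noteq> w \<Longrightarrow> j \<noteq> w \<Longrightarrow> (i, j) \<in> E \<Longrightarrow> (i, j) \<in> F"
  shows "simple_path F p"
  using assms(1) unfolding simple_path_def
  by (auto elim!: successively_mono) (metis assms(2,3))

text \<open>
  A path between vertices other than the leaf \<open>w\<close> avoids \<open>w\<close>, as it would have to pass \<open>r\<close> both
  before and after \<open>w\<close>.  So the common part of the two graphs, away from \<open>w\<close>, is connected and free of
  cycles.  Without neighbours of \<open>w\<close> the graph is disconnected, two of them close a cycle through \<open>w\<close>,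
  and a single one cannot.
\<close>

lemma tree_exchange_leaf:
  assumes tree: "undirected_tree T" and w: "w \<in> pverts T" and leaf: "nbrs T w = {r}"
    and G: "pair_graph G" "pverts G = pverts T"
    and same: "\<And>i j. i \<noteq> w \<Longrightarrow> j \<noteq> w \<Longrightarrow> (i, j) \<in> parcs G \<longleftrightarrow> (i, j) \<in> parcs T"
  shows "undirected_tree G \<longleftrightarrow> card (nbrs G w) = 1"
proof -
  have T: "pair_graph T" using tree by (simp add: undirected_tree_iff)
  interpret T: pair_graph T by fact
  interpret G: pair_graph G by fact
  have link: "\<exists>p. set p \<subseteq> pverts G - {w} \<and> simple_path (parcs G) p \<and> hd p = u \<and> last p = v"
    if uv: "u \<in> pverts G - {w}" "v \<in> pverts G - {w}" for u v
  proof -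
    obtain p where p: "set p \<subseteq> pverts T" "simple_path (parcs T) p" "hd p = u" "last p = v"
      using tree uv G(2) unfolding undirected_tree_iff path_linked_def by blast
    have "w \<notin> set p"
    proof
      assume "w \<in> set p"
      then obtain xs ys where p_eq: "p = xs @ w # ys" by (meson split_list)
      then have ne: "xs \<noteq> []" "ys \<noteq> []" using p uv by auto
      then have "(last xs, w) \<in> parcs T" "(w, hd ys) \<in> parcs T"
        using p(2) p_eq by (auto simp: simple_path_def successively_append_iff successively_Cons)
      then have "last xs = r" "hd ys = r" using leaf T.arcs_symmetric by (auto simp: nbrs_def)
      then show False using p(2) p_eq ne last_in_set[of xs] hd_in_set[of ys]
        by (auto simp: simple_path_def)
    qed
    then show ?thesis using p G(2) simple_path_congI[OF p(2), of w "parcs G"] same by blast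
  qed
  have r: "r \<in> pverts G - {w}"
    using leaf T.in_arcsD2 T.no_loops' G(2) by (fastforce simp: nbrs_def)
  show ?thesis
  proof
    assume Gt: "undirected_tree G"
    \<comment> \<open>by connectedness \<open>w\<close> has a neighbour\<close>
    obtain b where b: "b \<in> nbrs G w"
      using tree_branch[OF Gt, of w r] r w G(2) by auto
    \<comment> \<open>two neighbours \<open>b\<close> and \<open>c\<close> are joined by a path that avoids \<open>w\<close>, and \<open>w\<close> closes it up\<close>
    have "c = b" if c: "c \<in> nbrs G w" for c
    proof (rule ccontr)
      assume "c \<noteq> b"
      have bc: "(w, b) \<in> parcs G" "(c, w) \<in> parcs G" using b c G.arcs_symmetric by (auto simp: nbrs_def)
      then have "b \<in> pverts G - {w}" "c \<in> pverts G - {w}"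
        using G.in_arcsD1 G.in_arcsD2 G.no_loops' by fastforce+
      then obtain p where p: "set p \<subseteq> pverts G - {w}" "simple_path (parcs G) p" "hd p = b" "last p = c"
        using link by blast
      then have "2 \<le> length p" using \<open>c \<noteq> b\<close>
        by (cases p rule: remdups_adj.cases) (auto simp: simple_path_def)
      then have "closed_path (parcs G) (w # p)" using p bc
        by (auto simp: closed_path_def simple_path_def successively_Cons)
      then show False using Gt by (auto simp: undirected_tree_iff)
    qed
    then have "nbrs G w = {b}" using b by blast
    then show "card (nbrs G w) = 1" by simp
  next
    assume "card (nbrs G w) = 1"
    then obtain b where b: "nbrs G w = {b}" by (auto simp: card_1_singleton_iff)
    have wb: "(w, b) \<in> parcs G" "(b, w) \<in> parcs G" using b G.arcs_symmetric by (auto simp: nbrs_def)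
    then have bV: "b \<in> pverts G - {w}" using G.in_arcsD2 G.no_loops' by fastforce
    have to_w: "path_linked G u w" if u: "u \<in> pverts G" for u
    proof (cases "u = w")
      case True
      then show ?thesis using u unfolding path_linked_def
        by (intro exI[of _ "[w]"]) (auto simp: simple_path_def)
    next
      case False
      then obtain p where p: "set p \<subseteq> pverts G - {w}" "simple_path (parcs G) p" "hd p = u" "last p = b"
        using link[of u b] u bV by blast
      then show ?thesis unfolding path_linked_def using wb w G(2)
        by (intro exI[of _ "p @ [w]"]) (auto simp: simple_path_def successively_append_iff)
    qed
    have sym: "path_linked G v u" if "path_linked G u v" for u v
    proof -
      obtain p where p: "set p \<subseteq> pverts G" "simple_path (parcs G) p" "hd p = u" "last p = v"
        using \<open>path_linked G u v\<close> by (auto simp: path_linked_def)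
      then have "p \<noteq> []" by (simp add: simple_path_def)
      then show ?thesis unfolding path_linked_def using p simple_path_rev[OF G(1)]
        by (intro exI[of _ "rev p"]) (auto simp: hd_rev last_rev)
    qed
    have linked: "path_linked G u v" if "u \<in> pverts G" "v \<in> pverts G" for u v
    proof (cases "u = w \<or> v = w")
      case True
      then show ?thesis using to_w sym that by blast
    next
      case False
      then show ?thesis using link[of u v] that unfolding path_linked_def by blast
    qed
    have "\<not> closed_path (parcs G) p" for p
    proof
      assume p: "closed_path (parcs G) p"
      show False
      proof (cases "w \<in> set p")
        case False
        have ends: "p \<noteq> []" "(last p, hd p) \<in> parcs G"
          using p by (auto simp: closed_path_def simple_path_def)
        then have "last p \<noteq> w" "hd p \<noteq> w"
          using False last_in_set[of p] hd_in_set[of p] by metis+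
        then have "(last p, hd p) \<in> parcs T" using same ends by blast
        moreover have "simple_path (parcs T) p"
          by (rule simple_path_congI[of "parcs G" p w]) (use p False same in \<open>auto simp: closed_path_def\<close>)
        ultimately show False using tree p by (auto simp: undirected_tree_iff closed_path_def)
      next
        case True
        then obtain xs ys where "p = xs @ w # ys" by (meson split_list)
        \<comment> \<open>the two neighbours of \<open>w\<close> on a cycle are different, but \<open>w\<close> has only one\<close>
        then have R: "closed_path (parcs G) (w # ys @ xs)" using closed_path_rotate p by fastforce
        define q where "q = ys @ xs"
        have q: "2 \<le> length q" "distinct q" "(w, hd q) \<in> parcs G" "(last q, w) \<in> parcs G"
          using R unfolding q_def[symmetric] by (auto simp: closed_path_def simple_path_def successively_Cons split: if_splits)
        then have "hd q = b" "last q = b" using b G.arcs_symmetric by (auto simp: nbrs_def)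
        then show False using q(1,2) by (cases q rule: remdups_adj.cases) (auto split: if_splits)
      qed
    qed
    then show "undirected_tree G" using linked G(1) w G(2) by (auto simp: undirected_tree_iff)
  qed
qed

section \<open>The Moore-Penrose inverse of a full rank factorization\<close>

text \<open>
  Unlike the carrier formulation of associativity, these premises contain no dimension that occurs
  only in them, so that rewriting can discharge them.
\<close>

lemma mult_assoc_dim:
  "dim_col A = dim_row B \<Longrightarrow> dim_col B = dim_row D \<Longrightarrow> A * B * D = A * (B * D)"
  for A B D :: "'a :: semiring_0 mat"
  by (rule assoc_mult_mat) auto

text \<open>
  The four equations force \<open>A X = A Y\<close> and \<open>X A = Y A\<close>, because a product of symmetric matrices equals the
  transpose of the product in the opposite order; then \<open>X = X A X = X A Y = Y A Y = Y\<close>.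
\<close>

lemma is_moore_penrose_unique:
  assumes "A \<in> carrier_mat m k" "is_moore_penrose A X" "is_moore_penrose A Y"
  shows "X = Y"
proof -
  have X: "X \<in> carrier_mat k m" "A * X * A = A" "X * A * X = X"
      "transpose_mat (A * X) = A * X" "transpose_mat (X * A) = X * A"
    and Y: "Y \<in> carrier_mat k m" "A * Y * A = A" "Y * A * Y = Y"
      "transpose_mat (A * Y) = A * Y" "transpose_mat (Y * A) = Y * A"
    using assms by (auto simp: is_moore_penrose_def)
  note dims = carrier_matD[OF assms(1)] carrier_matD[OF X(1)] carrier_matD[OF Y(1)]
  have "A * X = A * Y * A * X" using Y(2) by simp
  also have "\<dots> = A * Y * (A * X)" using dims by (simp add: mult_assoc_dim)
  also have "\<dots> = transpose_mat (A * X * (A * Y))"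
    using assms(1) X(1,4) Y(1,4) transpose_mult[of "A * X" m m "A * Y" m] by simp
  also have "A * X * (A * Y) = A * X * A * Y" using dims by (simp add: mult_assoc_dim)
  also have "\<dots> = A * Y" using X(2) by simp
  finally have AX: "A * X = A * Y" using Y(4) by simp
  have "X * A = X * (A * Y * A)" using Y(2) by simp
  also have "\<dots> = X * A * (Y * A)" using dims by (simp add: mult_assoc_dim)
  also have "\<dots> = transpose_mat (Y * A * (X * A))"
    using assms(1) X(1,5) Y(1,5) transpose_mult[of "Y * A" k k "X * A" k] by simp
  also have "Y * A * (X * A) = Y * (A * X * A)" using dims by (simp add: mult_assoc_dim)
  also have "\<dots> = Y * A" using X(2) by simp
  finally have XA: "X * A = Y * A" using Y(5) by simp
  have "X = X * (A * X)" using dims X(3) by (simp add: mult_assoc_dim)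
  also have "\<dots> = X * A * Y" using dims AX by (simp add: mult_assoc_dim)
  also have "\<dots> = Y" using XA Y(3) by simp
  finally show ?thesis .
qed

lemma moore_penrose_eqI:
  assumes "A \<in> carrier_mat m k" "is_moore_penrose A X"
  shows "moore_penrose A = X"
  unfolding moore_penrose_def using assms is_moore_penrose_unique by blast

text \<open>
  The left inverse \<open>P'\<close> and the right inverse \<open>Q'\<close> cancel in the middle, so that the two products of
  \<open>P B Q\<close> and \<open>Q' C P'\<close> collapse to the symmetric matrices \<open>P P'\<close> and \<open>Q' Q\<close>.
\<close>

lemma is_moore_penrose_full_rank_factorization:
  fixes B C P P' Q Q' :: "real mat"
  assumes car: "B \<in> carrier_mat k k" "C \<in> carrier_mat k k" "P \<in> carrier_mat m k" "P' \<in> carrier_mat k m"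
      "Q \<in> carrier_mat k l" "Q' \<in> carrier_mat l k"
    and BC: "B * C = 1\<^sub>m k" "C * B = 1\<^sub>m k"
    and P: "P' * P = 1\<^sub>m k" "transpose_mat (P * P') = P * P'"
    and Q: "Q * Q' = 1\<^sub>m k" "transpose_mat (Q' * Q) = Q' * Q"
  shows "is_moore_penrose (P * B * Q) (Q' * C * P')"
proof -
  note dims = car[THEN carrier_matD(1)] car[THEN carrier_matD(2)]
  have cancel: "B * (C * Z) = Z" "C * (B * Z) = Z" "P' * (P * Z) = Z" "Q * (Q' * Z) = Z"
    if "dim_row Z = k" for Z :: "real mat"
    using that BC P(1) Q(1) dims
    by (simp_all add: mult_assoc_dim[symmetric] left_mult_one_mat')
  have AX: "P * B * Q * (Q' * C * P') = P * P'"
    using dims by (simp add: mult_assoc_dim cancel)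
  have XA: "Q' * C * P' * (P * B * Q) = Q' * Q"
    using dims by (simp add: mult_assoc_dim cancel)
  have AXA: "P * P' * (P * B * Q) = P * B * Q"
    using dims by (simp add: mult_assoc_dim cancel)
  have XAX: "Q' * Q * (Q' * C * P') = Q' * C * P'"
    using dims by (simp add: mult_assoc_dim cancel)
  show ?thesis unfolding is_moore_penrose_def AX XA AXA XAX
    using P(2) Q(2) dims by (intro conjI carrier_matI) auto
qed

text \<open>
  Multiplication by this matrix from the left replaces row \<open>l\<close> by copies of it in all rows \<open>i\<close> with
  \<open>\<phi> i = l\<close>, scaled by \<open>f i\<close>.
\<close>

definition inflation :: "nat \<Rightarrow> nat \<Rightarrow> (nat \<Rightarrow> nat) \<Rightarrow> (nat \<Rightarrow> real) \<Rightarrow> real mat" where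
  "inflation m k \<phi> f = mat m k (\<lambda>(i, l). if \<phi> i = l then f i else 0)"

lemma inflation_carrier [simp]: "inflation m k \<phi> f \<in> carrier_mat m k"
  and inflation_dim [simp]: "dim_row (inflation m k \<phi> f) = m" "dim_col (inflation m k \<phi> f) = k"
  by (simp_all add: inflation_def)

lemma inflation_sandwich:
  assumes K: "K \<in> carrier_mat k k" and \<phi>: "\<And>i. i < m \<Longrightarrow> \<phi> i < k" and ij: "i < m" "j < m"
  shows "(inflation m k \<phi> f * K * transpose_mat (inflation m k \<phi> g)) $$ (i, j) = f i * K $$ (\<phi> i, \<phi> j) * g j"
proof -
  have 1: "(inflation m k \<phi> f * K) $$ (i, l) = f i * K $$ (\<phi> i, l)" if "l < k" for l
    using K ij that \<phi>[OF ij(1)]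
    by (simp add: scalar_prod_def inflation_def if_distrib[of "\<lambda>x. x * _"] sum.delta cong: if_cong)
  have "(inflation m k \<phi> f * K * transpose_mat (inflation m k \<phi> g)) $$ (i, j)
      = (\<Sum>l\<in>{0..<k}. (inflation m k \<phi> f * K) $$ (i, l) * (if \<phi> j = l then g j else 0))"
    using K ij by (simp add: scalar_prod_def inflation_def)
  also have "\<dots> = f i * K $$ (\<phi> i, \<phi> j) * g j"
    using \<phi>[OF ij(2)] 1 by (simp add: if_distrib[of "\<lambda>x. _ * x"] cong: if_cong)
  finally show ?thesis .
qed

text \<open>
  The columns of an inflation matrix have disjoint supports and are therefore orthogonal.  Dividing each
  of them by its squared norm \<open>N l\<close> gives the transpose of the pseudo-inverse, which is again an inflation
  matrix over the same map.
\<close>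

lemma inflation_pseudo_inverse:
  fixes m k :: nat and \<phi> :: "nat \<Rightarrow> nat" and f :: "nat \<Rightarrow> real"
  defines "N \<equiv> \<lambda>l. \<Sum>i\<in>{i. i < m \<and> \<phi> i = l}. (f i)\<^sup>2"
  defines "g \<equiv> \<lambda>i. f i / N (\<phi> i)"
  assumes \<phi>: "\<And>i. i < m \<Longrightarrow> \<phi> i < k" and N: "\<And>l. l < k \<Longrightarrow> N l \<noteq> 0"
  shows "transpose_mat (inflation m k \<phi> g) * inflation m k \<phi> f = 1\<^sub>m k"
    and "transpose_mat (inflation m k \<phi> f * transpose_mat (inflation m k \<phi> g))
         = inflation m k \<phi> f * transpose_mat (inflation m k \<phi> g)"
    and "transpose_mat (inflation m k \<phi> f) * inflation m k \<phi> g = 1\<^sub>m k"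
    and "transpose_mat (inflation m k \<phi> g * transpose_mat (inflation m k \<phi> f))
         = inflation m k \<phi> g * transpose_mat (inflation m k \<phi> f)"
proof -
  have prod: "(\<Sum>i\<in>{0..<m}. (if \<phi> i = l then g i else 0) * (if \<phi> i = l' then f i else 0))
     = (if l = l' then 1 else 0)" if "l < k" for l l'
  proof -
    have "(\<Sum>i\<in>{0..<m}. (if \<phi> i = l then g i else 0) * (if \<phi> i = l' then f i else 0))
       = (if l = l' then (\<Sum>i\<in>{i. i < m \<and> \<phi> i = l}. (f i)\<^sup>2 / N l) else 0)"
      by (auto simp: g_def power2_eq_square intro!: sum.neutral sum.mono_neutral_cong_right split: if_splits)
    also have "\<dots> = (if l = l' then 1 else 0)"
      using N[OF that] by (auto simp: sum_divide_distrib[symmetric] N_def)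
    finally show ?thesis .
  qed
  show "transpose_mat (inflation m k \<phi> g) * inflation m k \<phi> f = 1\<^sub>m k"
    by (rule eq_matI) (use prod in \<open>auto simp: scalar_prod_def inflation_def\<close>)
  have "(\<Sum>i\<in>{0..<m}. (if \<phi> i = l then f i else 0) * (if \<phi> i = l' then g i else 0))
     = (if l = l' then 1 else 0)" if "l' < k" for l l'
    using prod[OF that, of l] by (simp add: mult.commute eq_commute[of l l'])
  then show "transpose_mat (inflation m k \<phi> f) * inflation m k \<phi> g = 1\<^sub>m k"
    by (intro eq_matI) (auto simp: scalar_prod_def inflation_def)
  have "(inflation m k \<phi> f' * transpose_mat (inflation m k \<phi> g')) $$ (i, j)
      = (if \<phi> i = \<phi> j then f' i * g' j else 0)" if "i < m" "j < m" for i j f' g'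
    using that \<phi>[OF that(1)] \<phi>[OF that(2)]
    by (simp add: scalar_prod_def inflation_def if_distrib[of "\<lambda>x. x * _"] cong: if_cong)
  note entry = this
  show "transpose_mat (inflation m k \<phi> f * transpose_mat (inflation m k \<phi> g))
         = inflation m k \<phi> f * transpose_mat (inflation m k \<phi> g)"
   and "transpose_mat (inflation m k \<phi> g * transpose_mat (inflation m k \<phi> f))
         = inflation m k \<phi> g * transpose_mat (inflation m k \<phi> f)"
    by (rule eq_matI; auto simp: entry g_def simp del: index_mult_mat(1))+
qed

section \<open>The inverse of the leading principal submatrix\<close>

lemma pair_graph_graph_of_mat: "pair_graph (graph_of_mat K)"
proof
  have "parcs (graph_of_mat K) \<subseteq> pverts (graph_of_mat K) \<times> pverts (graph_of_mat K)"
    by (auto simp: graph_of_mat_def)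
  then show "finite (parcs (graph_of_mat K))"
    by (rule finite_subset) (auto simp: graph_of_mat_def)
qed (auto simp: graph_of_mat_def symmetric_def sym_def)

text \<open>
  Fixing the inverse \<open>C\<close> of the submatrix from the outset turns the description of its entries into
  the verification that given vectors solve linear systems.
\<close>

locale pendant_treeangle =
  fixes n r :: nat and T :: "nat pair_pre_digraph" and A C :: "real mat"
  assumes size: "3 \<le> n" and tree: "undirected_tree T" and verts: "pverts T = {0..<n + 1}"
    and leaf: "nbrs T n = {r}" and carrier: "A \<in> carrier_mat (n + 1) (n + 1)"
    and treeangle: "treeangle T A"
    and edge: "\<forall>(i, j)\<in>parcs T. A $$ (i, j) \<noteq> 0 \<or> A $$ (j, i) \<noteq> 0"
    and interior: "\<forall>i\<in>pverts T. interior_vertex T i \<longrightarrow> A $$ (i, i) \<noteq> 0"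
    and C: "C \<in> carrier_mat n n" "mat_delete A n n * C = 1\<^sub>m n" "C * mat_delete A n n = 1\<^sub>m n"
begin

abbreviation a :: "nat \<Rightarrow> nat \<Rightarrow> real" where "a i j \<equiv> A $$ (i, j)"
abbreviation M :: "nat \<Rightarrow> nat set" where "M i \<equiv> nbrs T i - {n}"

lemma pair_graph_T: "pair_graph T"
  using tree by (simp add: undirected_tree_iff)

sublocale T: pair_graph T by (rule pair_graph_T)

lemma nbrsD: "j \<in> nbrs T i \<Longrightarrow> i < n + 1 \<and> j < n + 1 \<and> i \<noteq> j \<and> i \<in> nbrs T j"
  using T.in_arcsD1[of i j] T.in_arcsD2[of i j] T.no_loops'[of i j] T.arcs_symmetric[of i j]
  by (auto simp: nbrs_def verts)

lemma finite_nbrs: "finite (nbrs T i)"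
  by (rule finite_subset[of _ "{..<n+1}"]) (use nbrsD in auto)

lemma r_less: "r < n"
  using nbrsD[of r n] leaf by auto

text \<open>
  Both the nonvanishing of the \<open>2 \<times> 2\<close> minors and the columns of \<open>C\<close> are read off from solutions of
  linear systems in this form, which keeps the tree combinatorics free of matrix products.
\<close>

lemma solution_via_inverse:
  assumes "\<And>x. x < n \<Longrightarrow> (\<Sum>k<n. a x k * f k) = g x" and k: "k < n"
  shows "f k = (\<Sum>m<n. C $$ (k, m) * g m)"
proof -
  let ?B = "mat_delete A n n"
  have B: "?B \<in> carrier_mat n n" using carrier by (simp add: mat_delete_def)
  have "?B *\<^sub>v vec n f = vec n g"
  proof (rule eq_vecI)
    fix x assume "x < dim_vec (vec n g)"
    then show "(?B *\<^sub>v vec n f) $ x = vec n g $ x"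
      using carrier assms(1)[of x] by (simp add: scalar_prod_def mat_delete_def lessThan_atLeast0)
  qed (use B in auto)
  then have "C *\<^sub>v vec n g = (C * ?B) *\<^sub>v vec n f"
    using assoc_mult_mat_vec[OF C(1) B, of "vec n f"] by simp
  then have "vec n f $ k = (C *\<^sub>v vec n g) $ k" using C(3) by simp
  then show ?thesis using k C(1) by (simp add: scalar_prod_def lessThan_atLeast0)
qed

text \<open>
  The neighbour \<open>b\<close> of \<open>i\<close> towards \<open>x\<close> is not the deleted leaf, since a path cannot continue from there.
\<close>

lemma branch:
  assumes i: "i < n" and x: "x < n" and "x \<noteq> i"
  shows "\<exists>b\<in>M i. a x i * a b b = a x b * a b i \<and> (\<forall>j\<in>M i - {b}. a x j * a i i = a x i * a i j)"
proof -
  obtain b where b: "b \<in> nbrs T i" "b = x \<or> (\<exists>c\<in>nbrs T b. c \<noteq> i)" "lies_on_path T x i b"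
      "\<forall>j\<in>nbrs T i - {b}. lies_on_path T x j i"
    using tree_branch[OF tree, of i x] assms by (auto simp: verts)
  have "b \<noteq> n" using b(1,2) leaf x nbrsD[OF b(1)] by auto
  moreover have "a x i * a b b = a x b * a b i"
    using treeangle b(3) nbrsD[OF b(1)] i x by (auto simp: treeangle_def verts)
  moreover have "a x j * a i i = a x i * a i j" if j: "j \<in> M i - {b}" for j
    using treeangle b(4) j nbrsD[of j i] i x by (auto simp: treeangle_def verts)
  ultimately show ?thesis using b(1) by blast
qed

lemma other_index: "\<exists>x<n. x \<noteq> i"
  by (cases "i = 0") (use size in \<open>auto intro: exI[of _ 1] exI[of _ 0]\<close>)

text \<open>Since there are vertices besides \<open>r\<close> and its leaf, \<open>r\<close> has a second neighbour and is interior.\<close>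

lemma a_rr: "a r r \<noteq> 0"
proof -
  obtain x where x: "x < n" "x \<noteq> r" using other_index by blast
  obtain b where b: "b \<in> nbrs T r" "b \<noteq> n" using branch[OF r_less x] by blast
  have "n \<in> nbrs T r" using nbrsD[of r n] leaf by auto
  then have "card {b, n} \<le> card (nbrs T r)" using b finite_nbrs by (intro card_mono) auto
  then have "interior_vertex T r" using b by (simp add: interior_vertex_def)
  then show ?thesis using interior r_less by (auto simp: verts)
qed

lemma zero_diag_leaf:
  assumes "a i i = 0" and j: "j \<in> nbrs T i"
  shows "nbrs T i = {j}"
proof -
  have "i \<in> pverts T" using nbrsD[OF j] by (auto simp: verts)
  then have "card (nbrs T i) \<le> card {j}"
    using interior assms(1) by (force simp: interior_vertex_def)
  then show ?thesis using card_seteq[of "nbrs T i" "{j}"] finite_nbrs j by blast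
qed

text \<open>Two adjacent leaves would form a component of their own.\<close>

lemma edge_diag:
  assumes i: "i < n" and j: "j \<in> M i"
  shows "a i i \<noteq> 0 \<or> a j j \<noteq> 0"
proof (rule ccontr)
  assume "\<not> ?thesis"
  then have ij: "nbrs T i = {j}" "nbrs T j = {i}"
    using zero_diag_leaf j nbrsD[of j i] by blast+
  then show False using tree_branch[OF tree, of i n] i j by (auto simp: verts)
qed

text \<open>
  Columns \<open>i\<close> and \<open>j\<close> agree up to the factor \<open>a\<^bsub>ji\<^esub> / a\<^bsub>jj\<^esub>\<close> on the side of \<open>j\<close> of the edge, and on the side
  of \<open>i\<close> their discrepancy is a multiple of the minor.  If the minor vanished, the columns would be
  dependent, although the matrix is invertible.
\<close>

lemma minor_nonzero_aux:
  assumes i: "i < n" and j: "j \<in> M i" and "a j j \<noteq> 0"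
  shows "minor2 A i j \<noteq> 0"
proof
  assume d: "minor2 A i j = 0"
  have jn: "j < n" "j \<noteq> i" using nbrsD[of j i] j by auto
  define f where "f k = (if k = i then a j j else if k = j then - a j i else 0)" for k
  have "(\<Sum>k<n. a x k * f k) = 0" if x: "x < n" for x
  proof -
    have "(\<Sum>k<n. a x k * f k) = (\<Sum>k\<in>{i, j}. a x k * f k)"
      by (rule sum.mono_neutral_right) (use i jn in \<open>auto simp: f_def\<close>)
    also have "\<dots> = a x i * a j j - a x j * a j i" using jn by (auto simp: f_def)
    also have "\<dots> = 0"
    proof (cases "x = i")
      case True
      then show ?thesis using d by (simp add: minor2_def)
    next
      case False
      obtain b where b: "b \<in> M i" "a x i * a b b = a x b * a b i"
          "\<forall>j\<in>M i - {b}. a x j * a i i = a x i * a i j"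
        using branch[OF i x False] by blast
      show ?thesis
      proof (cases "b = j")
        case False
        then have xj: "a x j * a i i = a x i * a i j" using b(3) j by blast
        have "a i i \<noteq> 0" using zero_diag_leaf[of i j] b(1) j False by auto
        moreover have "a i i * (a x i * a j j - a x j * a j i) = a x i * minor2 A i j"
          using xj by (simp add: minor2_def algebra_simps)
        ultimately show ?thesis using d by simp
      qed (use b in simp)
    qed
    finally show ?thesis .
  qed
  then have "f i = (\<Sum>m<n. C $$ (i, m) * 0)" by (rule solution_via_inverse) (use i in auto)
  then show False using \<open>a j j \<noteq> 0\<close> by (simp add: f_def)
qed

lemma minor_nonzero:
  assumes i: "i < n" and j: "j \<in> M i"
  shows "minor2 A i j \<noteq> 0"
proof (cases "a j j = 0")
  case True
  then have "minor2 A j i \<noteq> 0"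
    using minor_nonzero_aux[of j i] edge_diag[OF i j] nbrsD[of j i] i j by auto
  then show ?thesis by (simp add: minor2_def mult.commute)
qed (use minor_nonzero_aux[OF i j] in simp)

text \<open>
  For each neighbour \<open>k\<close> of \<open>i\<close>, the combination \<open>a\<^bsub>ii\<^esub> col\<^sub>k - a\<^bsub>ik\<^esub> col\<^sub>i\<close> of columns is zero outside the
  branch behind \<open>k\<close>, and there, scaled by \<open>a\<^bsub>ki\<^esub> / d\<^bsub>ik\<^esub>\<close>, it coincides with \<open>col\<^sub>i\<close>.  Subtracting these
  restrictions from \<open>col\<^sub>i\<close> leaves \<open>a\<^bsub>ii\<^esub>\<close> times the \<open>i\<close>-th unit vector; the coefficient that \<open>col\<^sub>i\<close>
  receives in the process is \<open>a\<^bsub>ii\<^esub> s\<^sub>i\<close>.  In row \<open>x\<close> only the branch that contains \<open>x\<close>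
  contributes.
\<close>

lemma interior_column_equation:
  assumes i: "i < n" and x: "x < n" and a_ii: "a i i \<noteq> 0"
  shows "s_val T A n i * a x i - (\<Sum>k\<in>M i. a k i / minor2 A i k * a x k) = (if x = i then 1 else 0)"
proof -
  define R where "R K = (\<Sum>k\<in>K. a i k * a k i / minor2 A i k)" for K
  have s: "a i i * s_val T A n i = 1 + R (M i)" using a_ii by (simp add: s_val_def R_def)
  show ?thesis
  proof (cases "x = i")
    case True
    then show ?thesis using s by (simp add: R_def mult.commute)
  next
    case False
    obtain b where b: "b \<in> M i" "a x i * a b b = a x b * a b i"
        "\<forall>j\<in>M i - {b}. a x j * a i i = a x i * a i j"
      using branch[OF i x False] by blast
    define d where "d = minor2 A i b"
    have d: "d \<noteq> 0" "a i i * a b b = d + a i b * a b i"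
      using minor_nonzero[OF i b(1)] by (simp_all add: d_def minor2_def)
    have R: "R (M i) = a i b * a b i / d + R (M i - {b})"
      unfolding R_def d_def using finite_nbrs b(1) by (intro sum.remove) auto
    have "(\<Sum>k\<in>M i. a k i / minor2 A i k * a x k)
        = a b i / d * a x b + (\<Sum>k\<in>M i - {b}. a k i / minor2 A i k * a x k)"
      unfolding d_def using finite_nbrs b(1) by (intro sum.remove) auto
    then have "a i i * (\<Sum>k\<in>M i. a k i / minor2 A i k * a x k)
        = a i i * (a b i / d * a x b) + (\<Sum>k\<in>M i - {b}. a i i * (a k i / minor2 A i k * a x k))"
      by (simp only: distrib_left sum_distrib_left)
    also have "(\<Sum>k\<in>M i - {b}. a i i * (a k i / minor2 A i k * a x k)) = a x i * R (M i - {b})"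
      unfolding R_def sum_distrib_left
    proof (rule sum.cong[OF refl])
      fix k assume "k \<in> M i - {b}"
      then have k: "a x k * a i i = a x i * a i k" using b(3) by blast
      have "a i i * (a k i / minor2 A i k * a x k) = (a x k * a i i) * a k i / minor2 A i k" by simp
      also have "\<dots> = a x i * (a i k * a k i / minor2 A i k)" unfolding k by simp
      finally show "a i i * (a k i / minor2 A i k * a x k) = a x i * (a i k * a k i / minor2 A i k)" .
    qed
    also have "a i i * (a b i / d * a x b) = a i i * (a x b * a b i) / d" by simp
    also have "\<dots> = a x i * (a i i * a b b) / d" unfolding b(2)[symmetric] by simp
    also have "\<dots> = a x i * (1 + a i b * a b i / d)" unfolding d(2) using d(1)
      by (simp add: add_divide_distrib distrib_left)
    also have "a x i * (1 + a i b * a b i / d) + a x i * R (M i - {b}) = a x i * (a i i * s_val T A n i)"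
      unfolding s R by (simp add: distrib_left)
    finally have "a i i * (s_val T A n i * a x i - (\<Sum>k\<in>M i. a k i / minor2 A i k * a x k)) = 0"
      by (auto simp: right_diff_distrib mult.commute mult.left_commute)
    then have "s_val T A n i * a x i - (\<Sum>k\<in>M i. a k i / minor2 A i k * a x k) = 0"
      using a_ii mult_eq_0_iff by blast
    then show ?thesis using False by simp
  qed
qed

text \<open>
  At a leaf the number \<open>s\<^sub>i\<close> may involve a division by \<open>a\<^bsub>ii\<^esub> = 0\<close>.  Its value for \<open>a\<^bsub>ii\<^esub> \<noteq> 0\<close> simplifies to
  \<open>a\<^bsub>jj\<^esub> / d\<^bsub>ij\<^esub>\<close>, which remains correct in the degenerate case.
\<close>

lemma leaf_column_equation:
  assumes i: "i < n" and x: "x < n" and Mi: "M i = {j}"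
  shows "a j j / minor2 A i j * a x i - a j i / minor2 A i j * a x j = (if x = i then 1 else 0)"
proof -
  have d: "minor2 A i j \<noteq> 0" using minor_nonzero[OF i] Mi by blast
  have "a j j / minor2 A i j * a x i - a j i / minor2 A i j * a x j
      = (a x i * a j j - a x j * a j i) / minor2 A i j"
    by (simp add: diff_divide_distrib mult.commute)
  also have "\<dots> = (if x = i then 1 else 0)"
  proof (cases "x = i")
    case True
    then show ?thesis using d by (simp add: minor2_def)
  next
    case False
    then have "a x i * a j j = a x j * a j i" using branch[OF i x False] unfolding Mi by blast
    then show ?thesis using False by simp
  qed
  finally show ?thesis .
qed

lemma column_equation:
  assumes i: "i < n"
  shows "\<exists>s. (a i i \<noteq> 0 \<longrightarrow> s = s_val T A n i) \<and>
    (\<forall>x<n. s * a x i - (\<Sum>k\<in>M i. a k i / minor2 A i k * a x k) = (if x = i then 1 else 0))"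
proof (cases "a i i = 0")
  case False
  show ?thesis using interior_column_equation[OF i _ False] by blast
next
  case True
  obtain y where y: "y < n" "y \<noteq> i" using other_index by blast
  obtain j where j: "j \<in> M i" using branch[OF i y] by blast
  then have Mi: "M i = {j}" using zero_diag_leaf[OF True, of j] by auto
  show ?thesis
    by (rule exI[of _ "a j j / minor2 A i j"]) (use True leaf_column_equation[OF i _ Mi] in \<open>auto simp: Mi\<close>)
qed

lemma inverse_column:
  assumes i: "i < n"
  shows "\<exists>s. (a i i \<noteq> 0 \<longrightarrow> s = s_val T A n i) \<and>
    (\<forall>k<n. C $$ (k, i) = (if k = i then s else if k \<in> M i then - a k i / minor2 A i k else 0))"
proof -
  obtain s where s: "a i i \<noteq> 0 \<longrightarrow> s = s_val T A n i"
    and eq: "\<forall>x<n. s * a x i - (\<Sum>k\<in>M i. a k i / minor2 A i k * a x k) = (if x = i then 1 else 0)"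
    using column_equation[OF i] by blast
  define f where "f k = (if k = i then s else if k \<in> M i then - a k i / minor2 A i k else 0)" for k
  have iM: "i \<notin> M i" "M i \<subseteq> {..<n}" using nbrsD[of _ i] by force+
  have col: "(\<Sum>k<n. a x k * f k) = (if x = i then 1 else 0)" if x: "x < n" for x
  proof -
    have "(\<Sum>k<n. a x k * f k) = (\<Sum>k\<in>insert i (M i). a x k * f k)"
      by (rule sum.mono_neutral_right) (use i iM in \<open>auto simp: f_def\<close>)
    also have "\<dots> = a x i * f i + (\<Sum>k\<in>M i. a x k * f k)"
      using finite_nbrs iM(1) by (intro sum.insert) auto
    also have "(\<Sum>k\<in>M i. a x k * f k) = (\<Sum>k\<in>M i. - (a k i / minor2 A i k * a x k))"
      using iM(1) by (intro sum.cong) (auto simp: f_def)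
    also have "a x i * f i + \<dots> = s * a x i - (\<Sum>k\<in>M i. a k i / minor2 A i k * a x k)"
      by (simp add: sum_negf f_def)
    finally show ?thesis using eq x by simp
  qed
  have "C $$ (k, i) = f k" if k: "k < n" for k
  proof -
    have "f k = (\<Sum>m<n. C $$ (k, m) * (if m = i then 1 else 0))" by (rule solution_via_inverse[OF col k])
    also have "\<dots> = C $$ (k, i)" using i by (simp add: if_distrib[of "\<lambda>x. _ * x"] cong: if_cong)
    finally show ?thesis by simp
  qed
  then show ?thesis using s unfolding f_def by blast
qed

lemma inverse_diag: "C $$ (r, r) = s_val T A n r"
  using inverse_column[OF r_less] a_rr r_less by auto

lemma inverse_nonzero_iff:
  assumes "k < n" "i < n" "k \<noteq> i"
  shows "C $$ (k, i) \<noteq> 0 \<longleftrightarrow> k \<in> M i \<and> a k i \<noteq> 0"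
proof -
  have "C $$ (k, i) = (if k \<in> M i then - a k i / minor2 A i k else 0)"
    using inverse_column[OF assms(2)] assms(1,3) by auto
  then show ?thesis using minor_nonzero[OF assms(2), of k] by simp
qed

section \<open>The Moore-Penrose inverse of the singular matrix\<close>

lemma last_column: "i < n \<Longrightarrow> a i n = a r n / a r r * a i r"
  and last_row: "i < n \<Longrightarrow> a n i = a n r / a r r * a r i"
proof -
  assume i: "i < n"
  obtain b where "b \<in> nbrs T n" "lies_on_path T i n b"
    using tree_branch[OF tree, of n i] i by (auto simp: verts)
  then have p: "lies_on_path T i n r" "lies_on_path T n i r"
    using leaf lies_on_path_sym[OF pair_graph_T] by auto
  moreover have "i \<in> pverts T" "r \<in> pverts T" "n \<in> pverts T" using i r_less by (auto simp: verts)
  ultimately have "a i n * a r r = a i r * a r n" "a n i * a r r = a n r * a r i"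
    using treeangle unfolding treeangle_def by blast+
  then show "a i n = a r n / a r r * a i r" "a n i = a n r / a r r * a r i"
    using a_rr by (simp_all add: field_simps)
qed

text \<open>
  A kernel vector \<open>v\<close> of \<open>A\<close>, with its last coordinate transferred to \<open>r\<close> with factor \<open>t\<close>, is in the kernel of
  the invertible submatrix and hence vanishes.  So \<open>v\<close> is determined by its last coordinate, which is
  nonzero, and the last row of \<open>A v = 0\<close> gives the corner entry.
\<close>

lemma corner:
  assumes "\<not> invertible_mat A"
  shows "a n n = a n r * a r n / a r r"
proof -
  have "det A = 0"
  proof (rule ccontr)
    assume "det A \<noteq> 0"
    then have "A \<in> Units (ring_mat TYPE(real) (n + 1) ())"
      by (rule det_non_zero_imp_unit[OF carrier])
    then show False using assms carrier
      by (auto simp: Units_def ring_mat_def invertible_mat_def inverts_mat_def)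
  qed
  then obtain v where v: "v \<in> carrier_vec (n + 1)" "v \<noteq> 0\<^sub>v (n + 1)" "A *\<^sub>v v = 0\<^sub>v (n + 1)"
    using det_0_iff_vec_prod_zero[OF carrier] by auto
  define t where "t = a r n / a r r"
  have row: "(\<Sum>k<n. a x k * v $ k) + a x n * v $ n = 0" if "x < n + 1" for x
  proof -
    have "(A *\<^sub>v v) $ x = (\<Sum>k<n + 1. a x k * v $ k)"
      using that carrier v(1) by (simp add: scalar_prod_def lessThan_atLeast0)
    then show ?thesis using v(3) that by simp
  qed
  define f where "f k = v $ k + (if k = r then t * v $ n else 0)" for k
  have sum_f: "(\<Sum>k<n. a x k * f k) = (\<Sum>k<n. a x k * v $ k) + a x r * t * v $ n" for x
    using r_less by (simp add: f_def distrib_left sum.distrib if_distrib[of "\<lambda>x. _ * x"] cong: if_cong)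
  have "(\<Sum>k<n. a x k * f k) = 0" if "x < n" for x
    using row[of x] last_column[OF that] that unfolding sum_f t_def by (simp add: mult.commute)
  then have f0: "f k = 0" if "k < n" for k
    using solution_via_inverse[of f "\<lambda>_. 0" k] that by simp
  have "v $ n \<noteq> 0"
  proof
    assume v0: "v $ n = 0"
    have "v = 0\<^sub>v (n + 1)"
    proof (rule eq_vecI)
      fix k assume "k < dim_vec (0\<^sub>v (n + 1) :: real vec)"
      then show "v $ k = 0\<^sub>v (n + 1) $ k" using f0[of k] v0 by (cases "k = n") (auto simp: f_def split: if_splits)
    qed (use v in auto)
    then show False using v(2) by simp
  qed
  moreover have "(a n n - a n r * t) * v $ n = 0"
  proof -
    have "(\<Sum>k<n. a n k * f k) = 0" using f0 by (intro sum.neutral) auto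
    then have "a n n * v $ n = a n r * t * v $ n" using row[of n] sum_f[of n] by linarith
    then show ?thesis by (simp add: left_diff_distrib)
  qed
  ultimately show ?thesis by (simp add: t_def)
qed

text \<open>
  The index \<open>n\<close> is treated as a second copy of \<open>r\<close>, with weight \<open>z / a\<^bsub>rr\<^esub>\<close> where \<open>z\<close> is \<open>a\<^bsub>nr\<^esub>\<close> for rows
  and \<open>a\<^bsub>rn\<^esub>\<close> for columns.  The coweights are the weights of the pseudo-inverse.
\<close>

definition base :: "nat \<Rightarrow> nat" where "base i = (if i = n then r else i)"
definition weight :: "real \<Rightarrow> nat \<Rightarrow> real" where "weight z i = (if i = n then z / a r r else 1)"
definition coweight :: "real \<Rightarrow> nat \<Rightarrow> real" where
  "coweight z i = weight z i / (\<Sum>j\<in>{j. j < n + 1 \<and> base j = base i}. (weight z j)\<^sup>2)"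

lemma base_less: "i < n + 1 \<Longrightarrow> base i < n"
  using r_less by (simp add: base_def)

lemma weight_norm_nonzero:
  assumes "l < n"
  shows "(\<Sum>j\<in>{j. j < n + 1 \<and> base j = l}. (weight z j)\<^sup>2) \<noteq> 0"
proof -
  have "(weight z l)\<^sup>2 \<le> (\<Sum>j\<in>{j. j < n + 1 \<and> base j = l}. (weight z j)\<^sup>2)"
    by (rule member_le_sum) (use assms in \<open>auto simp: base_def\<close>)
  then show ?thesis using assms by (simp add: weight_def)
qed

lemma coweight_eq_0_iff: "i < n + 1 \<Longrightarrow> coweight z i = 0 \<longleftrightarrow> i = n \<and> z = 0"
  using weight_norm_nonzero[OF base_less, of i z] a_rr by (auto simp: coweight_def weight_def)

lemma A_factorization:
  assumes "\<not> invertible_mat A"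
  shows "A = inflation (n + 1) n base (weight (a n r)) * mat_delete A n n
           * transpose_mat (inflation (n + 1) n base (weight (a r n)))"
proof (rule eq_matI, goal_cases)
  case (1 i j)
  then have ij: "i < n + 1" "j < n + 1" by auto
  have B: "mat_delete A n n \<in> carrier_mat n n" using carrier by (simp add: mat_delete_def)
  have Bij: "mat_delete A n n $$ (base i, base j) = a (base i) (base j)"
    using base_less[OF ij(1)] base_less[OF ij(2)] carrier by (simp add: mat_delete_def)
  have "a i j = weight (a n r) i * a (base i) (base j) * weight (a r n) j"
    using ij last_column[of i] last_row[of j] corner[OF assms] a_rr
    by (auto simp: weight_def base_def less_Suc_eq)
  then show ?case using inflation_sandwich[OF B base_less ij] Bij by simp
qed (use carrier in auto)

lemma moore_penrose_entry:
  assumes "\<not> invertible_mat A"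
  shows "moore_penrose A \<in> carrier_mat (n + 1) (n + 1)"
    and "i < n + 1 \<Longrightarrow> j < n + 1 \<Longrightarrow>
      moore_penrose A $$ (i, j) = coweight (a r n) i * C $$ (base i, base j) * coweight (a n r) j"
proof -
  let ?I = "inflation (n + 1) n base"
  have B: "mat_delete A n n \<in> carrier_mat n n" using carrier by (simp add: mat_delete_def)
  note pinv = inflation_pseudo_inverse[where m = "n + 1" and k = n and \<phi> = base and f = "weight z" for z,
      OF base_less weight_norm_nonzero, folded coweight_def]
  have "is_moore_penrose A (?I (coweight (a r n)) * C * transpose_mat (?I (coweight (a n r))))"
    by (subst A_factorization[OF assms],
        rule is_moore_penrose_full_rank_factorization[of _ n _ _ "n + 1" _ _ "n + 1"])
      (use B C pinv in auto)
  then have mp: "moore_penrose A = ?I (coweight (a r n)) * C * transpose_mat (?I (coweight (a n r)))"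
    by (rule moore_penrose_eqI[OF carrier])
  show "moore_penrose A \<in> carrier_mat (n + 1) (n + 1)" unfolding mp by (rule carrier_matI) simp_all
  show "i < n + 1 \<Longrightarrow> j < n + 1 \<Longrightarrow>
      moore_penrose A $$ (i, j) = coweight (a r n) i * C $$ (base i, base j) * coweight (a n r) j"
    unfolding mp by (rule inflation_sandwich[OF C(1) base_less])
qed

section \<open>The graph of the Moore-Penrose inverse\<close>

lemma edge_iff:
  assumes "\<not> invertible_mat A" "i < n" "j < n"
  shows "(i, j) \<in> parcs (graph_of_mat (moore_penrose A)) \<longleftrightarrow> (i, j) \<in> parcs T"
proof (cases "i = j")
  case True
  then show ?thesis using T.no_loops'[of i j] by (auto simp: graph_of_mat_def)
next
  case False
  have "(i, j) \<in> parcs (graph_of_mat (moore_penrose A)) \<longleftrightarrow> C $$ (i, j) \<noteq> 0 \<or> C $$ (j, i) \<noteq> 0"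
    using assms False moore_penrose_entry(1)[OF assms(1)]
    by (simp add: graph_of_mat_def base_def moore_penrose_entry(2)[OF assms(1)] coweight_eq_0_iff)
  also have "\<dots> \<longleftrightarrow> (i, j) \<in> parcs T"
    using inverse_nonzero_iff[of i j] inverse_nonzero_iff[of j i] assms False edge
      T.arcs_symmetric[of i j] T.arcs_symmetric[of j i] by (auto simp: nbrs_def)
  finally show ?thesis .
qed

text \<open>
  The case distinction in the definition of \<open>H\<close> amounts to a disjunction, because at least one of
  \<open>a\<^bsub>rn\<^esub>\<close> and \<open>a\<^bsub>nr\<^esub>\<close> is nonzero.
\<close>

lemma H_set_eq:
  "H_set T A n r = (\<lambda>j. {j, n}) ` {j \<in> M r. (a r n \<noteq> 0 \<and> a r j \<noteq> 0) \<or> (a n r \<noteq> 0 \<and> a j r \<noteq> 0)}"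
proof -
  have "(n, r) \<in> parcs T" using leaf by (auto simp: nbrs_def)
  then have nz: "a n r \<noteq> 0 \<or> a r n \<noteq> 0" using edge by auto
  have N: "N' T A n r = (\<lambda>j. {j, n}) ` {j \<in> M r. a j r \<noteq> 0}"
    "N'' T A n r = (\<lambda>j. {j, n}) ` {j \<in> M r. a r j \<noteq> 0}"
    unfolding N'_def N''_def by blast+
  show ?thesis
  proof (cases "a r n = 0 \<or> a n r = 0")
    case True
    then show ?thesis using nz by (cases "a r n = 0") (simp_all add: H_set_def N)
  next
    case False
    then have "H_set T A n r = N' T A n r \<union> N'' T A n r" by (simp add: H_set_def)
    also have "\<dots> = (\<lambda>j. {j, n}) ` ({j \<in> M r. a j r \<noteq> 0} \<union> {j \<in> M r. a r j \<noteq> 0})"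
      unfolding N image_Un ..
    also have "{j \<in> M r. a j r \<noteq> 0} \<union> {j \<in> M r. a r j \<noteq> 0}
        = {j \<in> M r. (a r n \<noteq> 0 \<and> a r j \<noteq> 0) \<or> (a n r \<noteq> 0 \<and> a j r \<noteq> 0)}"
      using False by blast
    finally show ?thesis .
  qed
qed

text \<open>
  The new row and column are multiples of row and column \<open>r\<close> of \<open>C\<close>, so \<open>n\<close> inherits the neighbours
  of \<open>r\<close>, subject to orientation, and is joined to \<open>r\<close> itself through the diagonal entry \<open>s\<^sub>r\<close>.
\<close>

lemma nbrs_n:
  assumes "\<not> invertible_mat A"
  shows "nbrs (graph_of_mat (moore_penrose A)) n
    = {j. j = r \<and> s_val T A n r \<noteq> 0} \<union>
      {j \<in> M r. (a r n \<noteq> 0 \<and> a r j \<noteq> 0) \<or> (a n r \<noteq> 0 \<and> a j r \<noteq> 0)}"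
proof -
  have "(n, r) \<in> parcs T" using leaf by (auto simp: nbrs_def)
  then have nz: "a n r \<noteq> 0 \<or> a r n \<noteq> 0" using edge by auto
  have G: "j \<in> nbrs (graph_of_mat (moore_penrose A)) n \<longleftrightarrow>
      j < n \<and> ((a r n \<noteq> 0 \<and> C $$ (r, j) \<noteq> 0) \<or> (a n r \<noteq> 0 \<and> C $$ (j, r) \<noteq> 0))" for j
  proof (cases "j < n")
    case True
    then have "moore_penrose A $$ (n, j) \<noteq> 0 \<longleftrightarrow> a r n \<noteq> 0 \<and> C $$ (r, j) \<noteq> 0"
      "moore_penrose A $$ (j, n) \<noteq> 0 \<longleftrightarrow> C $$ (j, r) \<noteq> 0 \<and> a n r \<noteq> 0"
      by (simp_all add: moore_penrose_entry(2)[OF assms] coweight_eq_0_iff base_def)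
    then show ?thesis using True moore_penrose_entry(1)[OF assms]
      by (auto simp: nbrs_def graph_of_mat_def)
  next
    case False
    then show ?thesis using moore_penrose_entry(1)[OF assms]
      by (auto simp: nbrs_def graph_of_mat_def)
  qed
  show ?thesis
  proof (rule Set.set_eqI)
    fix j
    show "j \<in> nbrs (graph_of_mat (moore_penrose A)) n \<longleftrightarrow> j \<in> {j. j = r \<and> s_val T A n r \<noteq> 0} \<union>
      {j \<in> M r. (a r n \<noteq> 0 \<and> a r j \<noteq> 0) \<or> (a n r \<noteq> 0 \<and> a j r \<noteq> 0)}"
    proof (cases "j = r")
      case True
      then show ?thesis unfolding G using nz r_less inverse_diag nbrsD[of r r] by auto
    next
      case False
      then show ?thesis unfolding G
        using inverse_nonzero_iff[of r j] inverse_nonzero_iff[of j r] r_less nbrsD[of j r] nbrsD[of r j]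
        by auto
    qed
  qed
qed

lemma tree_iff:
  assumes "\<not> invertible_mat A"
  shows "undirected_tree (graph_of_mat (moore_penrose A)) \<longleftrightarrow>
           (s_val T A n r \<noteq> 0 \<and> H_set T A n r = {}) \<or>
           (s_val T A n r = 0 \<and> is_singleton (H_set T A n r))"
proof -
  let ?G = "graph_of_mat (moore_penrose A)"
  define K where "K = {j \<in> M r. (a r n \<noteq> 0 \<and> a r j \<noteq> 0) \<or> (a n r \<noteq> 0 \<and> a j r \<noteq> 0)}"
  have V: "pverts ?G = {0..<n + 1}"
    using moore_penrose_entry(1)[OF assms] by (auto simp: graph_of_mat_def)
  have same: "(i, j) \<in> parcs ?G \<longleftrightarrow> (i, j) \<in> parcs T" if "i \<noteq> n" "j \<noteq> n" for i j
  proof (cases "i < n \<and> j < n")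
    case True
    then show ?thesis using edge_iff[OF assms] by blast
  next
    case False
    have "i < n \<and> j < n" if "(i, j) \<in> parcs K" "pair_graph K" "pverts K = {0..<n + 1}" for K
    proof -
      interpret K: pair_graph K by fact
      show ?thesis using K.in_arcsD1[OF that(1)] K.in_arcsD2[OF that(1)] that(3) \<open>i \<noteq> n\<close> \<open>j \<noteq> n\<close>
        by auto
    qed
    then show ?thesis using False V verts pair_graph_T pair_graph_graph_of_mat by blast
  qed
  have "undirected_tree ?G \<longleftrightarrow> card (nbrs ?G n) = 1"
    by (rule tree_exchange_leaf[OF tree _ leaf pair_graph_graph_of_mat])
      (use V verts same in auto)
  also have "nbrs ?G n = {j. j = r \<and> s_val T A n r \<noteq> 0} \<union> K"
    unfolding K_def by (rule nbrs_n[OF assms])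
  also have "card \<dots> = (if s_val T A n r = 0 then 0 else 1) + card K"
  proof -
    have "finite K" "r \<notin> K" using finite_nbrs nbrsD[of r r] by (auto simp: K_def)
    then show ?thesis by auto
  qed
  also have "\<dots> = (if s_val T A n r = 0 then 0 else 1) + card (H_set T A n r)"
    unfolding H_set_eq K_def[symmetric]
    by (subst card_image) (auto simp: inj_on_def K_def doubleton_eq_iff)
  finally have count: "undirected_tree ?G \<longleftrightarrow> (if s_val T A n r = 0 then 0 else 1) + card (H_set T A n r) = 1" .
  have "finite (H_set T A n r)" unfolding H_set_eq using finite_nbrs by simp
  then show ?thesis unfolding count is_singleton_altdef by simp
qed

end

theorem corollary2p8:
  fixes n r :: nat and \<Gamma> :: "nat pair_pre_digraph" and A :: "real mat"
  assumes "n \<ge> 3"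
    and "undirected_tree \<Gamma>" and "pverts \<Gamma> = {0..<n + 1}"
    and "pendant \<Gamma> n" and "nbrs \<Gamma> n = {r}"
    and "A \<in> carrier_mat (n + 1) (n + 1)"
    and "\<not> invertible_mat A"
    and "treeangle \<Gamma> A"
    and "\<forall>(i, j)\<in>parcs \<Gamma>. A $$ (i, j) \<noteq> 0 \<or> A $$ (j, i) \<noteq> 0"
    and "\<forall>i\<in>pverts \<Gamma>. interior_vertex \<Gamma> i \<longrightarrow> A $$ (i, i) \<noteq> 0"
    and "invertible_mat (mat_delete A n n)"
  shows "undirected_tree (graph_of_mat (moore_penrose A)) \<longleftrightarrow>
           (s_val \<Gamma> A n r \<noteq> 0 \<and> H_set \<Gamma> A n r = {}) \<or>
           (s_val \<Gamma> A n r = 0 \<and> is_singleton (H_set \<Gamma> A n r))"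
proof -
  have B: "mat_delete A n n \<in> carrier_mat n n" using assms(6) by (simp add: mat_delete_def)
  then obtain C where C: "mat_delete A n n * C = 1\<^sub>m n" "C * mat_delete A n n = 1\<^sub>m (dim_row C)"
    using assms(11) by (auto simp: invertible_mat_def inverts_mat_def)
  have "dim_col C = n" using arg_cong[OF C(1), of dim_col] by simp
  moreover have "dim_row C = n" using arg_cong[OF C(2), of dim_col] carrier_matD[OF B] by simp
  ultimately interpret pendant_treeangle n r \<Gamma> A C
    using assms C by unfold_locales auto
  show ?thesis by (rule tree_iff[OF assms(7)])
qed

end
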